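(* Let $G$ be a connected graph. The following three statements are equivalent. (1) $|\Delta_{ef}|\neq 3$ for all non-adjacent edges $e$ and $f$ of $G$. (2) $\mathrm{diam}_G\leq 2$. (3) $\Delta_{ef}\subseteq\{1,2\}$ for all non-adjacent edges $e$ and $f$ of $G$. Thus, $\mathrm{diam}_G\geq 3$ if and only if there are non-adjacent edges $e$ and $f$ in $G$ with $|\Delta_{ef}|=3$.
   Context: Graphs are simple and undirected, with non-empty vertex set; $d$ is the shortest-path distance in $G$, and $\mathrm{diam}_G=\max_{u,v\in V(G)}d(u,v)$. For edges $e=\{a,b\}$ and $f=\{x,y\}$, $\Delta_{ef}$ is the set $\{d(a,x),d(b,y),d(a,y),d(b,x)\}$ (duplicates counted once). Two edges $e,f$ are adjacent if $e\cap f\neq\emptyset$, and non-adjacent otherwise. *)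

theory Defs
  imports "Graph_Theory.Graph_Theory"
begin

text \<open>
  A simple undirected graph is rendered as a symmetric loop-free digraph whose arcs are pairs of
  vertices (locale \<^locale>\<open>pair_bidirected_digraph\<close>), so that parallel edges cannot occur.
  The undirected edge between \<open>a\<close> and \<open>b\<close> is the set \<open>{a, b}\<close>, given by the two arcs
  \<open>(a, b)\<close> and \<open>(b, a)\<close>. Finiteness of the graph is not required. The predicate
  \<^const>\<open>Digraph_Component.connected\<close> includes that the vertex set is non-empty.
\<close>

definition edges :: "'a pair_pre_digraph \<Rightarrow> 'a set set" where
  "edges G = {{a, b} | a b. (a, b) \<in> parcs G}"

definition graph_dist :: "'a pair_pre_digraph \<Rightarrow> 'a \<Rightarrow> 'a \<Rightarrow> ereal" where
  "graph_dist G u v = wf_digraph.\<mu> (with_proj G) (\<lambda>_. 1) u v"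

text \<open>
  The diameter is the supremum of all distances; it is their maximum if the graph is finite
  (see \<open>diam_eq_Max\<close> below), and \<open>\<infinity>\<close> if the distances are unbounded.
\<close>

definition diam :: "'a pair_pre_digraph \<Rightarrow> ereal" where
  "diam G = (SUP (u, v) \<in> pverts G \<times> pverts G. graph_dist G u v)"

text \<open>
  Ranging over both endpoints makes the set independent of how the endpoints are named; see
  \<open>Delta_pair\<close> for the explicit form.
\<close>

definition Delta :: "'a pair_pre_digraph \<Rightarrow> 'a set \<Rightarrow> 'a set \<Rightarrow> ereal set" where
  "Delta G e f = {graph_dist G u v | u v. u \<in> e \<and> v \<in> f}"

definition adjacent_edges :: "'a set \<Rightarrow> 'a set \<Rightarrow> bool" where
  "adjacent_edges e f \<longleftrightarrow> e \<inter> f \<noteq> {}"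

lemma Delta_pair:
  "Delta G {a, b} {x, y} = {graph_dist G a x, graph_dist G b y, graph_dist G a y, graph_dist G b x}"
  unfolding Delta_def by blast

lemma graph_dist_eq_INF_length:
  assumes "pair_bidirected_digraph G"
  shows "graph_dist G u v = (INF p \<in> {p. pre_digraph.awalk (with_proj G) u p v}. ereal (real (length p)))"
proof -
  interpret pair_bidirected_digraph G by fact
  have "awalk_cost (\<lambda>_. 1) p = real (length p)" for p :: "('a \<times> 'a) list"
    by (induction p) auto
  then show ?thesis
    unfolding graph_dist_def \<mu>_def by simp
qed

lemma diam_eq_Max:
  assumes "finite (pverts G)" "pverts G \<noteq> {}"
  shows "diam G = Max {graph_dist G u v | u v. u \<in> pverts G \<and> v \<in> pverts G}"
proof -
  have *: "{graph_dist G u v | u v. u \<in> pverts G \<and> v \<in> pverts G}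
      = (\<lambda>(u, v). graph_dist G u v) ` (pverts G \<times> pverts G)"
    by auto
  show ?thesis
    unfolding diam_def * using assms by (subst Max_Sup) auto
qed

end

theory Submission
  imports Defs
begin

text \<open>
  Distances between vertices of a connected graph are natural numbers, and the endpoints of disjoint
  edges have positive distances, so diameter at most \<open>2\<close> forces \<open>\<Delta>\<close> into \<open>{1, 2}\<close>, which has fewer
  than three elements. Conversely, the first four vertices \<open>a, b, c, d\<close> of a geodesic of length at
  least \<open>3\<close> again form a geodesic, so that \<open>\<Delta> = {1, 2, 3}\<close> for the edges \<open>{a, b}\<close> and \<open>{c, d}\<close>.
\<close>

context pair_bidirected_digraph
begin

lemma graph_dist_le_length:
  assumes "awalk u p v"
  shows "graph_dist G u v \<le> ereal (real (length p))"
  unfolding graph_dist_eq_INF_length[OF pair_bidirected_digraph_axioms]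
  using assms by (auto intro: INF_lower)

text \<open>Lengths are natural numbers, so once some walk exists, one of minimal length exists and
  realises the infimum. Without a walk the infimum is over the empty set.\<close>

lemma graph_dist_attained:
  assumes "awalk u q v"
  obtains p where "awalk u p v" "graph_dist G u v = ereal (real (length p))"
proof -
  define p where "p = arg_min length (\<lambda>p. awalk u p v)"
  have p: "awalk u p v"
    unfolding p_def using assms by (rule arg_min_natI)
  have "length p \<le> length r" if "awalk u r v" for r
    unfolding p_def using that by (rule arg_min_nat_le)
  then have "ereal (real (length p)) \<le> graph_dist G u v"
    unfolding graph_dist_eq_INF_length[OF pair_bidirected_digraph_axioms]
    by (auto intro!: INF_greatest)
  with p graph_dist_le_length[OF p] show thesis
    by (intro that) auto
qed

lemma graph_dist_infinity:
  assumes "\<nexists>p. awalk u p v"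
  shows "graph_dist G u v = \<infinity>"
  using assms unfolding graph_dist_def
  by (intro shortest_path_inf) (simp add: reachable_awalk)

text \<open>Concatenate two shortest walks. If one of them is missing, the right-hand side is
  infinite, so membership in the vertex set need not be tracked.\<close>

lemma graph_dist_triangle:
  "graph_dist G u w \<le> graph_dist G u v + graph_dist G v w"
proof (cases "(\<exists>p. awalk u p v) \<and> (\<exists>q. awalk v q w)")
  case True
  then obtain p q where p: "awalk u p v" "graph_dist G u v = ereal (real (length p))"
    and q: "awalk v q w" "graph_dist G v w = ereal (real (length q))"
    by (metis graph_dist_attained)
  from p(1) q(1) have "awalk u (p @ q) w"
    by (rule awalk_appendI)
  from graph_dist_le_length[OF this] p q show ?thesis
    by simp
next
  case False
  then have "graph_dist G u v = \<infinity> \<or> graph_dist G v w = \<infinity>"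
    using graph_dist_infinity by blast
  then show ?thesis
    by auto
qed

text \<open>Connectedness is a statement about the symmetric closure; since the arcs of
  \<open>G\<close> are already symmetric, it yields walks in \<open>G\<close> itself.\<close>

lemma connected_obtains_awalk:
  assumes "Digraph_Component.connected (with_proj G)" "u \<in> pverts G" "v \<in> pverts G"
  obtains p where "awalk u p v"
proof -
  have "strongly_connected (with_proj G)"
    using pair_sym_arcs assms(1) by (rule symmetric_connected_imp_strongly_connected)
  then have "u \<rightarrow>\<^sup>*\<^bsub>with_proj G\<^esub> v"
    using assms(2,3) by (simp add: strongly_connected_def)
  then show thesis
    using that by (auto simp: reachable_awalk)
qed

text \<open>The number is the length of a shortest walk, and an empty walk has equal ends.\<close>

lemma graph_dist_nat:
  assumes "Digraph_Component.connected (with_proj G)" "u \<in> pverts G" "v \<in> pverts G"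
  obtains n where "graph_dist G u v = ereal (real n)" "n = 0 \<Longrightarrow> u = v"
proof -
  obtain q where "awalk u q v"
    using connected_obtains_awalk[OF assms] .
  then obtain p where "awalk u p v" "graph_dist G u v = ereal (real (length p))"
    by (rule graph_dist_attained)
  then show thesis
    by (intro that[of "length p"]) (auto simp: awalk_simps)
qed

lemma graph_dist_le_diam:
  "u \<in> pverts G \<Longrightarrow> v \<in> pverts G \<Longrightarrow> graph_dist G u v \<le> diam G"
  unfolding diam_def by (rule SUP_upper2[of "(u, v)"]) auto

text \<open>A supremum above 2 comes from a single distance above 2, which is at least 3 by
  integrality. This also covers an infinite diameter.\<close>

lemma diam_not_le_2:
  assumes conn: "Digraph_Component.connected (with_proj G)" and "\<not> diam G \<le> 2"
  obtains u v where "u \<in> pverts G" "v \<in> pverts G" "graph_dist G u v \<ge> 3"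
proof -
  from assms(2) obtain u v where uv: "u \<in> pverts G" "v \<in> pverts G" "\<not> graph_dist G u v \<le> 2"
    unfolding diam_def by (auto simp: SUP_le_iff)
  obtain n where "graph_dist G u v = ereal (real n)"
    using graph_dist_nat[OF conn uv(1,2)] .
  with uv show thesis
    by (intro that[of u v]) (auto simp: numeral_eq_ereal)
qed

lemma geodesic_of_length_3:
  assumes "awalk u q v" "graph_dist G u v \<ge> 3"
  obtains a b c d where "(a, b) \<in> parcs G" "(b, c) \<in> parcs G" "(c, d) \<in> parcs G"
    "graph_dist G a d \<ge> 3"
proof -
  obtain p where p: "awalk u p v" "graph_dist G u v = ereal (real (length p))"
    using assms(1) by (rule graph_dist_attained)
  with assms(2) have "length p \<ge> 3"
    by (simp add: numeral_eq_ereal)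
  then obtain e1 e2 e3 r where "p = e1 # e2 # e3 # r"
    by (auto simp: numeral_eq_Suc Suc_le_length_iff)
  with p(1) obtain b c d where arcs: "(u, b) \<in> parcs G" "(b, c) \<in> parcs G" "(c, d) \<in> parcs G"
    and r: "awalk d r v" and len: "length p = length r + 3"
    by (cases e1; cases e2; cases e3) (auto simp: awalk_simps)
  \<comment> \<open>A shorter way from \<open>u\<close> to \<open>d\<close>, continued along
    \<open>r\<close>, would beat the shortest walk \<open>p\<close>. The finite length of
    \<open>r\<close> then cancels.\<close>
  have "ereal (real (length r + 3)) \<le> graph_dist G u d + ereal (real (length r))"
    using graph_dist_triangle[of u v d] graph_dist_le_length[OF r] p(2) len
    by (metis add_left_mono order_trans)
  then have "graph_dist G u d \<ge> 3"
    by (cases "graph_dist G u d") (auto simp: numeral_eq_ereal)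
  with arcs show thesis
    by (rule that)
qed

lemma Delta_geodesic:
  assumes "(a, b) \<in> parcs G" "(b, c) \<in> parcs G" "(c, d) \<in> parcs G" "graph_dist G a d \<ge> 3"
  shows "\<not> adjacent_edges {a, b} {c, d}" "Delta G {a, b} {c, d} = {1, 2, 3}"
proof -
  have walks: "awalk a [(a, b)] b" "awalk b [(b, c)] c" "awalk c [(c, d)] d"
    "awalk a [(a, b), (b, c)] c" "awalk b [(b, c), (c, d)] d" "awalk a [(a, b), (b, c), (c, d)] d"
    using assms(1-3) by (auto simp: awalk_simps in_arcsD2)
  note upper = walks[THEN graph_dist_le_length]
  \<comment> \<open>Passing to natural numbers makes linear arithmetic available.\<close>
  have "\<exists>n. graph_dist G x y = ereal (real n)" if "awalk x p y" for x p y
    using that by (rule graph_dist_attained) blast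
  from walks[THEN this] obtain ab bc cd ac bd ad where n: "graph_dist G a b = ereal (real ab)"
    "graph_dist G b c = ereal (real bc)" "graph_dist G c d = ereal (real cd)"
    "graph_dist G a c = ereal (real ac)" "graph_dist G b d = ereal (real bd)"
    "graph_dist G a d = ereal (real ad)"
    by blast
  have "ab \<le> 1" "bc \<le> 1" "cd \<le> 1"
    "ac \<le> 2" "bd \<le> 2" "ad \<le> 3"
    using upper unfolding n by simp_all
  moreover have "ad \<ge> 3"
    using assms(4) unfolding n by (simp add: numeral_eq_ereal)
  \<comment> \<open>The walk bounds every distance above; the triangle inequalities carry the lower
    bound on \<open>ad\<close> over to \<open>ac\<close> and \<open>bd\<close>, and from
    \<open>ac\<close> to \<open>bc\<close>.\<close>
  moreover have "ad \<le> ac + cd" "ad \<le> ab + bd"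
    "ac \<le> ab + bc"
    using graph_dist_triangle[of a d c] graph_dist_triangle[of a d b] graph_dist_triangle[of a c b]
    unfolding n by simp_all
  ultimately have "bc = 1" "ac = 2" "bd = 2" "ad = 3"
    by linarith+
  then have vals: "graph_dist G b c = 1" "graph_dist G a c = 2" "graph_dist G b d = 2"
    "graph_dist G a d = 3"
    unfolding n by simp_all
  then show "Delta G {a, b} {c, d} = {1, 2, 3}"
    unfolding Delta_pair by auto
  \<comment> \<open>A common endpoint would turn one of the four positive distances into that of a
    vertex to itself.\<close>
  have "graph_dist G u u \<le> 0" if "u \<in> pverts G" for u
    using graph_dist_le_length[of u "[]" u] that by (simp add: awalk_simps zero_ereal_def)
  from this[of a] this[of b] show "\<not> adjacent_edges {a, b} {c, d}"
    using vals assms(1) unfolding adjacent_edges_def by (auto simp: in_arcsD1 in_arcsD2)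
qed

lemma Delta_subset_of_diam_le_2:
  assumes conn: "Digraph_Component.connected (with_proj G)" and "diam G \<le> 2"
    and "e \<in> edges G" "f \<in> edges G" "\<not> adjacent_edges e f"
  shows "Delta G e f \<subseteq> {1, 2}"
proof
  fix x assume "x \<in> Delta G e f"
  then obtain u v where x: "x = graph_dist G u v" and uv: "u \<in> e" "v \<in> f"
    unfolding Delta_def by blast
  have verts: "u \<in> pverts G" "v \<in> pverts G"
    using uv assms(3,4) unfolding edges_def by (auto dest: in_arcsD1 in_arcsD2)
  have "u \<noteq> v"
    using uv assms(5) unfolding adjacent_edges_def by blast
  then obtain n where n: "graph_dist G u v = ereal (real n)" "n \<noteq> 0"
    using graph_dist_nat[OF conn verts] by metis
  have "graph_dist G u v \<le> 2"
    using graph_dist_le_diam[OF verts] assms(2) by (rule order_trans)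
  with n have "n = 1 \<or> n = 2"
    by (auto simp: numeral_eq_ereal)
  with n x show "x \<in> {1, 2}"
    by (auto simp: numeral_eq_ereal one_ereal_def)
qed

lemma edges_with_three_distances:
  assumes conn: "Digraph_Component.connected (with_proj G)" and "\<not> diam G \<le> 2"
  obtains e f where "e \<in> edges G" "f \<in> edges G" "\<not> adjacent_edges e f" "card (Delta G e f) = 3"
proof -
  obtain u v where uv: "u \<in> pverts G" "v \<in> pverts G" "graph_dist G u v \<ge> 3"
    using diam_not_le_2[OF assms] .
  obtain q where "awalk u q v"
    using connected_obtains_awalk[OF conn uv(1,2)] .
  then obtain a b c d where abcd: "(a, b) \<in> parcs G" "(b, c) \<in> parcs G" "(c, d) \<in> parcs G"
    "graph_dist G a d \<ge> 3"
    using uv(3) by (rule geodesic_of_length_3)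
  moreover have "card {1, 2, 3 :: ereal} = 3"
    by (simp add: numeral_eq_ereal one_ereal_def)
  ultimately show thesis
    using Delta_geodesic[OF abcd] by (intro that[of "{a, b}" "{c, d}"]) (auto simp: edges_def)
qed

end

theorem proposition3p7:
  fixes G :: "'a pair_pre_digraph"
  assumes "pair_bidirected_digraph G"
    and "Digraph_Component.connected (with_proj G)"
  shows
    "((\<forall>e \<in> edges G. \<forall>f \<in> edges G. \<not> adjacent_edges e f \<longrightarrow> card (Delta G e f) \<noteq> 3)
        \<longleftrightarrow> diam G \<le> 2)
     \<and> (diam G \<le> 2
        \<longleftrightarrow> (\<forall>e \<in> edges G. \<forall>f \<in> edges G. \<not> adjacent_edges e f \<longrightarrow> Delta G e f \<subseteq> {1, 2}))
     \<and> (diam G \<ge> 3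
        \<longleftrightarrow> (\<exists>e \<in> edges G. \<exists>f \<in> edges G. \<not> adjacent_edges e f \<and> card (Delta G e f) = 3))"
    (is "(?P1 \<longleftrightarrow> ?P2) \<and> (?P2 \<longleftrightarrow> ?P3) \<and> (?Q \<longleftrightarrow> ?R)")
proof -
  interpret pair_bidirected_digraph G by fact
  note conn = assms(2)
  have 12: "?P1 \<Longrightarrow> ?P2"
    using edges_with_three_distances[OF conn] by metis
  have 23: "?P2 \<Longrightarrow> ?P3"
    using Delta_subset_of_diam_le_2[OF conn] by blast
  have "card (Delta G e f) \<noteq> 3" if "Delta G e f \<subseteq> {1, 2}" for e f
  proof -
    have "card (Delta G e f) \<le> card {1, 2 :: ereal}"
      using that by (intro card_mono) auto
    also have "\<dots> \<le> 2"
      by (simp add: card_insert_if)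
    finally show ?thesis by simp
  qed
  then have 31: "?P3 \<Longrightarrow> ?P1"
    by blast
  \<comment> \<open>An extended real could lie strictly between 2 and 3; integrality of the
    distances excludes this for the diameter.\<close>
  have "?Q \<longleftrightarrow> \<not> ?P2"
  proof
    assume ?Q
    then have "(2 :: ereal) < diam G"
      by (rule less_le_trans[rotated]) (simp add: numeral_eq_ereal)
    then show "\<not> ?P2"
      by simp
  next
    assume "\<not> ?P2"
    then obtain u v where uv: "u \<in> pverts G" "v \<in> pverts G" "graph_dist G u v \<ge> 3"
      using diam_not_le_2[OF conn] by blast
    show ?Q
      using uv(3) graph_dist_le_diam[OF uv(1,2)] by (rule order_trans)
  qed
  \<comment> \<open>\<open>?R\<close> is the negation of \<open>?P1\<close>, so the last equivalence
    is the first one negated.\<close>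
  with 12 23 31 show ?thesis
    by blast
qed

end
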